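(* For any integer $p\ge 1$, the problem MSR-A with a $p$-matroid constraint is an instance of maximizing a non-decreasing submodular function subject to a $(p+1)$-matroid.
   Context: $[n]=\{1,\dots,n\}$. For a set $E$, a function $f:2^E\to\mathbb{R}_+$ is submodular if $f(X\cup\{e\})-f(X)\ge f(Y\cup\{e\})-f(Y)$ for all $X\subseteq Y\subseteq E$ and $e\in E\setminus Y$; it is non-decreasing if $f(X)\le f(Y)$ for all $X\subseteq Y\subseteq E$. Functions are assumed, without loss of generality, to satisfy $f(\emptyset)=0$. A matroid on $E$ is a family of subsets of $E$ that is closed under taking subsets and satisfies augmentation: if $X,Y$ are in the family and $|X|<|Y|$, then $X\cup\{e\}$ is in the family for some $e\in Y\setminus X$. A $p$-matroid on $E$ is the intersection of $p$ matroids on $E$. Maximizing a function $g:2^E\to\mathbb{R}_+$ subject to a $q$-matroid $\mathcal{N}\subseteq 2^E$ means finding $S\in\mathcal{N}$ that maximizes $g(S)$. Sequences: let $V$ be a set of $n$ items. For a sequence $\sigma$ formed by items of $V$, $\sigma_t$ is its $t$-th item, $V(\sigma)\subseteq V$ is the set of items in $\sigma$, and for $R\subseteq[n]$, $\sigma[R]=\{\sigma_t: t\in R\}$. At a slot of the sequence where no function is available, one is allowed not to place any item. MSR-A (maximum submodular ranking with availability): given $V$ and non-decreasing submodular functions $f_1,\dots,f_m:2^V\to\mathbb{R}_+$, each $f_i$ associated with a set $T_i\subseteq[n]$ of $k_i$ available slots, find a sequence $\sigma$ of items of $V$ maximizing $\sum_{i=1}^m f_i(\sigma[T_i])$. In MSR-A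 with a $p$-matroid constraint, a $p$-matroid $\mathcal{M}\subseteq 2^V$ is also given, and a feasible sequence must satisfy $V(\sigma)\in\mathcal{M}$. *)

theory Defs
  imports Complex_Main
begin

definition nondecreasing_on :: "'a set \<Rightarrow> ('a set \<Rightarrow> real) \<Rightarrow> bool" where
  "nondecreasing_on E f \<longleftrightarrow> (\<forall>X Y. X \<subseteq> Y \<longrightarrow> Y \<subseteq> E \<longrightarrow> f X \<le> f Y)"

definition submodular_on :: "'a set \<Rightarrow> ('a set \<Rightarrow> real) \<Rightarrow> bool" where
  "submodular_on E f \<longleftrightarrow>
     (\<forall>X Y e. X \<subseteq> Y \<longrightarrow> Y \<subseteq> E \<longrightarrow> e \<in> E - Y \<longrightarrow>
        f (Y \<union> {e}) - f Y \<le> f (X \<union> {e}) - f X)"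

(* Real-valued functions on all sets are only constrained, and only matter, on Pow E. *)
definition nondecreasing_submodular :: "'a set \<Rightarrow> ('a set \<Rightarrow> real) \<Rightarrow> bool" where
  "nondecreasing_submodular E f \<longleftrightarrow>
     (\<forall>X. X \<subseteq> E \<longrightarrow> 0 \<le> f X) \<and> f {} = 0 \<and> nondecreasing_on E f \<and> submodular_on E f"

(* The empty family is not excluded.  This is immaterial below: a matroid intersection
   that contains the empty set involves nonempty families only. *)
definition matroid :: "'a set \<Rightarrow> 'a set set \<Rightarrow> bool" where
  "matroid E F \<longleftrightarrow>
     F \<subseteq> Pow E \<and>
     (\<forall>X Y. Y \<in> F \<longrightarrow> X \<subseteq> Y \<longrightarrow> X \<in> F) \<and>
     (\<forall>X Y. X \<in> F \<longrightarrow> Y \<in> F \<longrightarrow> card X < card Y \<longrightarrow> (\<exists>e \<in> Y - X. X \<union> {e} \<in> F))"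

definition p_matroid :: "nat \<Rightarrow> 'a set \<Rightarrow> 'a set set \<Rightarrow> bool" where
  "p_matroid p E F \<longleftrightarrow>
     (\<exists>M. (\<forall>j \<in> {1..p}. matroid E (M j)) \<and> F = {X. X \<subseteq> E \<and> (\<forall>j \<in> {1..p}. X \<in> M j)})"

definition submodular_max_instance ::
  "nat \<Rightarrow> 'a set \<Rightarrow> 'a set set \<Rightarrow> ('a set \<Rightarrow> real) \<Rightarrow> bool" where
  "submodular_max_instance q E N g \<longleftrightarrow>
     finite E \<and> p_matroid q E N \<and> nondecreasing_submodular E g"

(* A sequence over V is a partial map from the slots {1..card V} to V: the value None is a slot
   that holds no item, and no item is placed twice. *)
definition item_sequence :: "'a set \<Rightarrow> (nat \<rightharpoonup> 'a) \<Rightarrow> bool" where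
  "item_sequence V \<sigma> \<longleftrightarrow> dom \<sigma> \<subseteq> {1..card V} \<and> ran \<sigma> \<subseteq> V \<and> inj_on \<sigma> (dom \<sigma>)"

definition items_at :: "(nat \<rightharpoonup> 'a) \<Rightarrow> nat set \<Rightarrow> 'a set" where
  "items_at \<sigma> R = {v. \<exists>t \<in> R. \<sigma> t = Some v}"

definition msra_instance ::
  "nat \<Rightarrow> 'a set \<Rightarrow> nat \<Rightarrow> (nat \<Rightarrow> 'a set \<Rightarrow> real) \<Rightarrow> (nat \<Rightarrow> nat set) \<Rightarrow> 'a set set \<Rightarrow> bool" where
  "msra_instance p V m f T M \<longleftrightarrow>
     finite V \<and>
     (\<forall>i \<in> {1..m}. nondecreasing_submodular V (f i) \<and> T i \<subseteq> {1..card V}) \<and>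
     p_matroid p V M"

definition msra_feasible :: "'a set \<Rightarrow> 'a set set \<Rightarrow> (nat \<rightharpoonup> 'a) \<Rightarrow> bool" where
  "msra_feasible V M \<sigma> \<longleftrightarrow> item_sequence V \<sigma> \<and> ran \<sigma> \<in> M"

definition msra_value ::
  "nat \<Rightarrow> (nat \<Rightarrow> 'a set \<Rightarrow> real) \<Rightarrow> (nat \<Rightarrow> nat set) \<Rightarrow> (nat \<rightharpoonup> 'a) \<Rightarrow> real" where
  "msra_value m f T \<sigma> = (\<Sum>i = 1..m. f i (items_at \<sigma> (T i)))"

(* Maximizing h over S is maximizing g over N, a solution x being read as the set enc x.
   The encoding is a parameter, not existentially quantified: with a free choice of encoding and
   ground set, every finite problem with nonnegative values and a solution of value 0 would be
   submodular maximization over a rank-one matroid whose elements are the other solutions. *)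
definition is_instance_via ::
  "('s \<Rightarrow> 'e set) \<Rightarrow> 's set \<Rightarrow> ('s \<Rightarrow> real) \<Rightarrow> 'e set set \<Rightarrow> ('e set \<Rightarrow> real) \<Rightarrow> bool" where
  "is_instance_via enc S h N g \<longleftrightarrow> bij_betw enc S N \<and> (\<forall>x \<in> S. g (enc x) = h x)"

end

theory Submission
  imports Defs
begin

text \<open>
  A sequence is read as the set of its (slot, item) pairs.  The slot projection must be injective
  on such a set, which is a partition matroid.  Each of the \<open>p\<close> matroids on \<open>V\<close> is pulled back
  along the item projection, adding parallel copies of every item; since parallel elements are
  never independent together, the pullback already forbids placing an item twice.  This is where
  \<open>p \<ge> 1\<close> enters, and it is why one additional matroid suffices.
\<close>

text \<open>The free matroid; its pullback along the slot projection is the partition matroid.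
  Finiteness matters because \<open>card\<close> is 0 on infinite sets: an infinite \<open>X\<close>
  could contain a finite \<open>Y\<close> of larger \<open>card\<close>.\<close>

lemma matroid_Pow:
  assumes "finite E"
  shows "matroid E (Pow E)"
proof -
  have "\<exists>e\<in>Y - X. X \<union> {e} \<in> Pow E" if "X \<subseteq> E" "Y \<subseteq> E" "card X < card Y" for X Y
  proof -
    have "\<not> Y \<subseteq> X"
      using that assms by (meson card_mono finite_subset not_less)
    with that show ?thesis by auto
  qed
  then show ?thesis unfolding matroid_def by auto
qed

text \<open>Where \<open>h\<close> is injective it preserves cardinality, so augmentation can be
  carried out on the images. The new point lies outside the image of \<open>X\<close>, so any
  preimage of it in \<open>Y\<close> is outside \<open>X\<close> and keeps \<open>h\<close>
  injective.\<close>

lemma matroid_pullback: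
  assumes F: "matroid V F"
  shows "matroid E {X. X \<subseteq> E \<and> inj_on h X \<and> h ` X \<in> F}" (is "matroid E ?G")
proof -
  have down: "\<And>X Y. Y \<in> F \<Longrightarrow> X \<subseteq> Y \<Longrightarrow> X \<in> F"
    and augment: "\<And>X Y. X \<in> F \<Longrightarrow> Y \<in> F \<Longrightarrow> card X < card Y \<Longrightarrow> \<exists>e\<in>Y - X. X \<union> {e} \<in> F"
    using F unfolding matroid_def by simp_all
  have down_G: "X \<in> ?G" if "Y \<in> ?G" "X \<subseteq> Y" for X Y
    using that down[of "h ` Y" "h ` X"] inj_on_subset[of h Y X] image_mono[of X Y h] by auto
  have augment_G: "\<exists>e\<in>Y - X. X \<union> {e} \<in> ?G"
    if X: "X \<in> ?G" and Y: "Y \<in> ?G" and less: "card X < card Y" for X Y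
  proof -
    have "card (h ` X) < card (h ` Y)"
      using X Y less card_image[of h X] card_image[of h Y] by simp
    then obtain v where v: "v \<in> h ` Y - h ` X" "h ` X \<union> {v} \<in> F"
      using X Y augment[of "h ` X" "h ` Y"] by auto
    then obtain e where "e \<in> Y" "v = h e" by auto
    with X Y v show ?thesis
      by (intro bexI[of _ e]) auto
  qed
  show ?thesis
    unfolding matroid_def
  proof (intro conjI allI impI)
    show "?G \<subseteq> Pow E" by auto
  qed (erule (1) down_G, erule (2) augment_G)
qed

text \<open>Pulling back commutes with intersecting. Injectivity of \<open>h\<close> is imposed by
  each single pullback, so at least one is required: an empty intersection would be all of
  \<open>Pow E\<close>.\<close>

lemma p_matroid_pullback:
  assumes "p_matroid p V F" "p \<ge> 1" "h ` E \<subseteq> V"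
  shows "p_matroid p E {X. X \<subseteq> E \<and> inj_on h X \<and> h ` X \<in> F}"
proof -
  obtain M where M: "\<And>j. j \<in> {1..p} \<Longrightarrow> matroid V (M j)"
    and F: "F = {X. X \<subseteq> V \<and> (\<forall>j\<in>{1..p}. X \<in> M j)}"
    using assms(1) unfolding p_matroid_def by blast
  define M' where "M' j = {X. X \<subseteq> E \<and> inj_on h X \<and> h ` X \<in> M j}" for j
  have "{X. X \<subseteq> E \<and> inj_on h X \<and> h ` X \<in> F} = {X. X \<subseteq> E \<and> (\<forall>j\<in>{1..p}. X \<in> M' j)}"
    using assms(2,3) unfolding F M'_def by fastforce
  moreover have "matroid E (M' j)" if "j \<in> {1..p}" for j
    unfolding M'_def by (rule matroid_pullback[OF M[OF that]])
  ultimately show ?thesis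
    unfolding p_matroid_def by (intro exI[of _ M']) simp
qed

lemma p_matroid_Int_matroid:
  assumes "p_matroid p E F" "matroid E G"
  shows "p_matroid (p + 1) E (F \<inter> G)"
proof -
  obtain M where M: "\<And>j. j \<in> {1..p} \<Longrightarrow> matroid E (M j)"
    and F: "F = {X. X \<subseteq> E \<and> (\<forall>j\<in>{1..p}. X \<in> M j)}"
    using assms(1) unfolding p_matroid_def by blast
  have "{1..p + 1} = insert (p + 1) {1..p}" by auto
  with M F assms(2) show ?thesis
    unfolding p_matroid_def by (intro exI[of _ "M(p + 1 := G)"]) auto
qed

text \<open>The marginal of \<open>e\<close> is 0 outside \<open>A\<close>, and otherwise it is the
  marginal of \<open>h e\<close> under \<open>f\<close>. As \<open>h\<close> may identify elements
  of \<open>E\<close>, submodularity of \<open>f\<close> alone does not suffice; monotonicity covers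
  collisions.\<close>

lemma nondecreasing_submodular_image_Int:
  assumes f: "nondecreasing_submodular V f" and h: "h ` E \<subseteq> V"
  shows "nondecreasing_submodular E (\<lambda>X. f (h ` (X \<inter> A)))"
proof -
  have mono: "f X \<le> f Y" if "X \<subseteq> Y" "Y \<subseteq> V" for X Y
    using f that unfolding nondecreasing_submodular_def nondecreasing_on_def by blast
  have sub: "f (insert e Y) - f Y \<le> f (insert e X) - f X"
    if "X \<subseteq> Y" "Y \<subseteq> V" "e \<in> V - Y" for X Y e
    using f that unfolding nondecreasing_submodular_def submodular_on_def by simp
  have "f (h ` ((Y \<union> {e}) \<inter> A)) - f (h ` (Y \<inter> A))
      \<le> f (h ` ((X \<union> {e}) \<inter> A)) - f (h ` (X \<inter> A))"
    if "X \<subseteq> Y" "Y \<subseteq> E" "e \<in> E - Y" for X Y e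
  proof (cases "e \<in> A")
    case True
    have XY: "h ` (X \<inter> A) \<subseteq> h ` (Y \<inter> A)" "h ` (Y \<inter> A) \<subseteq> V" "h e \<in> V"
      using that h by auto
    show ?thesis
    \<comment> \<open>If \<open>h e\<close> is already present for \<open>Y\<close>, the larger set
      gains nothing, while the smaller one gains a nonnegative amount.\<close>
    proof (cases "h e \<in> h ` (Y \<inter> A)")
      case True
      moreover have "f (h ` (X \<inter> A)) \<le> f (insert (h e) (h ` (X \<inter> A)))"
        using XY by (intro mono) auto
      ultimately show ?thesis
        using \<open>e \<in> A\<close> by (simp add: insert_absorb)
    next
      case False
      then show ?thesis
        using sub[OF XY(1,2), of "h e"] XY(3) \<open>e \<in> A\<close> by simp
    qed
  qed simp
  moreover have "f (h ` (X \<inter> A)) \<le> f (h ` (Y \<inter> A))" if "X \<subseteq> Y" "Y \<subseteq> E" for X Y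
    using that h by (intro mono) auto
  moreover have "h ` (X \<inter> A) \<subseteq> V" if "X \<subseteq> E" for X
    using that h by auto
  ultimately show ?thesis
    using f unfolding nondecreasing_submodular_def nondecreasing_on_def submodular_on_def by auto
qed

lemma nondecreasing_submodular_sum:
  assumes "\<And>i. i \<in> I \<Longrightarrow> nondecreasing_submodular E (g i)"
  shows "nondecreasing_submodular E (\<lambda>X. \<Sum>i\<in>I. g i X)"
  using assms
  unfolding nondecreasing_submodular_def nondecreasing_on_def submodular_on_def
    \<comment> \<open>Differences of sums become sums of marginals, which can be compared term by
      term.\<close>
    sum_subtractf[symmetric]
  by (auto intro!: sum_nonneg sum_mono sum.neutral)

text \<open>Brings the objective into the image-of-intersection form whose submodularity is
  established above.\<close>

lemma items_at_graph: "items_at \<sigma> R = snd ` (Map.graph \<sigma> \<inter> R \<times> UNIV)"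
  unfolding items_at_def Map.graph_def by force

lemma inj_graph: "inj Map.graph"
proof (rule injI, rule ext)
  fix \<sigma> \<tau> :: "'a \<rightharpoonup> 'b" and t
  assume "Map.graph \<sigma> = Map.graph \<tau>"
  then have "\<sigma> t = Some v \<longleftrightarrow> \<tau> t = Some v" for v
    unfolding Map.graph_def by blast
  then show "\<sigma> t = \<tau> t" by (metis not_None_eq)
qed

lemma inj_on_fst_graph: "inj_on fst (Map.graph \<sigma>)"
  unfolding Map.graph_def by (auto intro: inj_onI)

lemma inj_on_fst_imp_graph:
  assumes "inj_on fst X"
  obtains \<sigma> where "Map.graph \<sigma> = X"
proof
  have "v = w" if "(t, v) \<in> X" "(t, w) \<in> X" for t v w
    using inj_onD[OF assms _ that] by simp
  then have "(THE v. (t, v) \<in> X) = v" if "(t, v) \<in> X" for t v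
    using that by blast
  \<comment> \<open>Injectivity of \<open>fst\<close> makes the item of each occupied slot unique,
    so \<open>THE\<close> is well defined; the other slots stay empty.\<close>
  then show "Map.graph (\<lambda>t. if t \<in> fst ` X then Some (THE v. (t, v) \<in> X) else None) = X"
    unfolding Map.graph_def by (force split: if_splits)
qed

lemma inj_on_snd_graph: "inj_on snd (Map.graph \<sigma>) \<longleftrightarrow> inj_on \<sigma> (dom \<sigma>)"
  unfolding Map.graph_def inj_on_def dom_def by auto

lemma item_sequence_iff_graph:
  "item_sequence V \<sigma> \<longleftrightarrow>
     Map.graph \<sigma> \<subseteq> {1..card V} \<times> V \<and> inj_on snd (Map.graph \<sigma>)"
  unfolding item_sequence_def inj_on_snd_graph
  by (auto simp: Map.graph_def dom_def ran_def)

lemma snd_graph: "snd ` Map.graph \<sigma> = ran \<sigma>"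
  unfolding Map.graph_def ran_def by force

theorem theorem5p1:
  fixes p m :: nat
    and V :: "'a set"
    and f :: "nat \<Rightarrow> 'a set \<Rightarrow> real"
    and T :: "nat \<Rightarrow> nat set"
    and M :: "'a set set"
  assumes "p \<ge> 1"
    and "msra_instance p V m f T M"
  shows "\<exists>N g. submodular_max_instance (p + 1) ({1..card V} \<times> V) N g \<and>
           is_instance_via Map.graph {\<sigma>. msra_feasible V M \<sigma>} (msra_value m f T) N g"
proof -
  let ?E = "{1..card V} \<times> V"
  \<comment> \<open>The first family carries \<open>M\<close> and the ban on repeated items; the
    second allows at most one item per slot.\<close>
  define N where "N = {X. X \<subseteq> ?E \<and> inj_on snd X \<and> snd ` X \<in> M} \<inter>
    {X. X \<subseteq> ?E \<and> inj_on fst X \<and> fst ` X \<in> Pow {1..card V}}"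
  \<comment> \<open>This extends the objective to all subsets of \<open>?E\<close>, including those
    with several items in one slot.\<close>
  define g where "g = (\<lambda>X :: (nat \<times> 'a) set. \<Sum>i = 1..m. f i (snd ` (X \<inter> T i \<times> UNIV)))"
  have V: "finite V" and f: "\<And>i. i \<in> {1..m} \<Longrightarrow> nondecreasing_submodular V (f i)"
    and M: "p_matroid p V M"
    using assms(2) unfolding msra_instance_def by auto
  have "p_matroid (p + 1) ?E N"
    unfolding N_def using assms(1) M
    by (intro p_matroid_Int_matroid p_matroid_pullback matroid_pullback[OF matroid_Pow]) auto
  moreover have "nondecreasing_submodular ?E g"
    unfolding g_def
    by (rule nondecreasing_submodular_sum, rule nondecreasing_submodular_image_Int[OF f]) auto
  moreover have "bij_betw Map.graph {\<sigma>. msra_feasible V M \<sigma>} N"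
  proof (rule bij_betw_imageI)
    show "inj_on Map.graph {\<sigma>. msra_feasible V M \<sigma>}"
      by (rule inj_on_subset[OF inj_graph]) simp
    \<comment> \<open>A graph meets the slot condition automatically; what remains is exactly
      feasibility.\<close>
    have graph_in_N: "Map.graph \<sigma> \<in> N \<longleftrightarrow> msra_feasible V M \<sigma>" for \<sigma>
      unfolding N_def msra_feasible_def item_sequence_iff_graph snd_graph[symmetric]
      using inj_on_fst_graph[of \<sigma>] by auto
    have "\<exists>\<sigma>. X = Map.graph \<sigma>" if "X \<in> N" for X
    proof -
      from that have "inj_on fst X" unfolding N_def by simp
      then show ?thesis by (metis inj_on_fst_imp_graph)
    qed
    with graph_in_N show "Map.graph ` {\<sigma>. msra_feasible V M \<sigma>} = N"
      by (auto simp: image_iff) metis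
  qed
  ultimately show ?thesis
    using V unfolding submodular_max_instance_def is_instance_via_def
    by (intro exI[of _ N] exI[of _ g]) (simp add: g_def msra_value_def items_at_graph)
qed

end
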